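(* The map $\epsilon:\mathbb P^*\to\mathbb P^*$ (defined in the context) is a bijective transformation of $\mathbb P^*$ such that for any piecewise decreasing and connected dashed patterns $p_1,p_2,\ldots,p_m$ and any $w\in\mathbb P^*$ we have $$(p_1,p_2,\ldots,p_m)(w)=(\mathrm R\,p_1,\mathrm R\,p_2,\ldots,\mathrm R\,p_m)\big(\epsilon(w)\big)$$ and $[\pi^{w}]=[\pi^{\epsilon(w)}]$ in $L(\mathcal B,\ll)$.
   Context: $\mathbb P$ is the set of positive integers and $\mathbb P^*$ the free monoid of finite words over $\mathbb P$. $\mathcal B$ is the set of nonempty finite strictly decreasing sequences of positive integers. For nonempty words $u,u'\in\mathbb P^*$, $u$ is below $u'$ if every letter of $u$ is smaller than every letter of $u'$; $u\ll u'$ iff $u=u'$ or $u$ is below $u'$; $u,u'$ are comparable if $u\ll u'$ or $u'\ll u$, and incomparable otherwise. Elements of the free monoid $\mathcal B^*$ are written $D_1|\cdots|D_k$. Two words of $\mathcal B^*$ are adjacent if one is obtained from the other by exchanging two consecutive letters that are distinct and comparable for $\ll$; two words are equivalent if equal or connected by a finite chain of consecutively adjacent words; $L(\mathcal B,\ll)$ is the quotient monoid and $[\pi]$ the class of $\pi$. For $w\in\mathbb P^*$, $\pi^w\in\mathcal B^*$ is the word whose letters are, from left to right, the descending runs (maximal contiguous strictly decreasing subsequences) of $w$. A word $D_1|\cdots|D_k\in\mathcal B^*$ is minimal (resp. maximal) if there is no $i$ such that $D_{i+1}$ is below $D_i$ (resp. $D_i$ is below $D_{i+1}$). By a known result of Foata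 and Randrianarivony, each equivalence class in $L(\mathcal B,\ll)$ contains exactly one minimal and exactly one maximal word; $\theta$ denotes the bijection sending each minimal word to the maximal word in the same class. Each $\pi^w$ is minimal. For $\pi=D_1|\cdots|D_k$, $\mathrm R\,\pi=D_k|\cdots|D_1$. The map $\epsilon$ sends $w\in\mathbb P^*$ to the word obtained from $\mathrm R(\theta(\pi^w))$ by deleting the vertical bars (concatenating its letters). A dashed pattern $p$ of length $q$ is a word $a_1\cdots a_q$ whose set of letters is exactly $\{1,\dots,r\}$ for some $r\geq1$, in which two adjacent letters may or may not be separated by a dash; it is written $p=\tau^{(1)}-\cdots-\tau^{(\ell)}$ with $\tau^{(i)}$ nonempty dash-free words. It is piecewise decreasing if each $\tau^{(i)}$ is strictly decreasing, and connected if for each $i=1,\dots,\ell-1$ the words $\tau^{(i)},\tau^{(i+1)}$ are incomparable or equal. $\mathrm R\,p=\tau^{(\ell)}-\cdots-\tau^{(1)}$. An occurrence of $p$ in $w=w_1\cdots w_n\in\mathbb P^*$ is a choice of positions $1\le i_1<\dots<i_q\le n$ such that $w_{i_s}>w_{i_t}$ iff $a_s>a_t$ for all $s,t$, and $i_{s+1}=i_s+1$ whenever $a_s,a_{s+1}$ are not separated by a dash. $(p_1,\ldots,p_m)(w)$ is the vector of numbers of occurrences of the patterns $p_1,\ldots,p_m$ in $w$.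
   Formalization: The last clause is false as printed (w=231: π^w=2|31 has a singleton class, ε(w)=312, π^{ε(w)}=31|2); it is corrected to [π^w]=[R π^{ε(w)}], with R reversing the order of the descending runs. *)

theory Defs
  imports Main
begin

text \<open>Words over the positive integers are lists of naturals with positive entries; words over
  \<open>BB\<close> (written with vertical bars in the literature) are lists of lists.\<close>

definition PP :: "nat list set" where
  "PP = lists {0<..}"

definition BB :: "nat list set" where
  "BB = {D \<in> PP. D \<noteq> [] \<and> sorted_wrt (>) D}"

subsection \<open>The quotient monoid\<close>

text \<open>The next three relations are only meant for nonempty words.\<close>

definition below :: "nat list \<Rightarrow> nat list \<Rightarrow> bool" where
  "below u v \<longleftrightarrow> (\<forall>x\<in>set u. \<forall>y\<in>set v. x < y)"

definition ll :: "nat list \<Rightarrow> nat list \<Rightarrow> bool" (infix "\<lless>" 50) where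
  "u \<lless> v \<longleftrightarrow> u = v \<or> below u v"

definition comparable :: "nat list \<Rightarrow> nat list \<Rightarrow> bool" where
  "comparable u v \<longleftrightarrow> u \<lless> v \<or> v \<lless> u"

definition adjacent :: "(nat list list \<times> nat list list) set" where
  "adjacent = {(\<pi>, \<rho>). \<pi> \<in> lists BB \<and> \<rho> \<in> lists BB \<and>
     (\<exists>\<alpha> \<beta> D E. \<pi> = \<alpha> @ [D, E] @ \<beta> \<and> \<rho> = \<alpha> @ [E, D] @ \<beta> \<and> D \<noteq> E \<and> comparable D E)}"

definition equivalent :: "(nat list list \<times> nat list list) set" where
  "equivalent = {(\<pi>, \<rho>). \<pi> \<in> lists BB \<and> \<rho> \<in> lists BB \<and> (\<pi>, \<rho>) \<in> adjacent\<^sup>*}"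

definition L_class :: "nat list list \<Rightarrow> nat list list set" where
  "L_class \<pi> = equivalent `` {\<pi>}"

subsection \<open>The map \<open>epsilon\<close>\<close>

fun desc_runs :: "nat list \<Rightarrow> nat list list" where
  "desc_runs [] = []"
| "desc_runs [x] = [[x]]"
| "desc_runs (x # y # zs) =
     (let r = desc_runs (y # zs) in if x > y then (x # hd r) # tl r else [x] # r)"

definition minimal :: "nat list list \<Rightarrow> bool" where
  "minimal \<pi> \<longleftrightarrow> \<not> (\<exists>i. Suc i < length \<pi> \<and> below (\<pi> ! Suc i) (\<pi> ! i))"

definition maximal :: "nat list list \<Rightarrow> bool" where
  "maximal \<pi> \<longleftrightarrow> \<not> (\<exists>i. Suc i < length \<pi> \<and> below (\<pi> ! i) (\<pi> ! Suc i))"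

text \<open>The description is unique on \<open>lists BB\<close> by a result of Foata and Randrianarivony: each class
  has exactly one minimal and exactly one maximal element. Only the values at minimal words matter.\<close>

definition theta :: "nat list list \<Rightarrow> nat list list" where
  "theta \<pi> = (THE \<rho>. \<rho> \<in> L_class \<pi> \<and> maximal \<rho>)"

text \<open>Since the reversal of a maximal word is minimal, the descending runs of \<open>epsilon w\<close> are the
  letters of \<open>rev (theta (desc_runs w))\<close>. Hence it is \<open>rev (desc_runs (epsilon w))\<close>, and in general
  not \<open>desc_runs (epsilon w)\<close>, that is equivalent to \<open>desc_runs w\<close>: for \<open>w = [2, 3, 1]\<close> the runs are
  \<open>[[2], [3, 1]]\<close>, whose class is a singleton, whereas \<open>epsilon w = [3, 1, 2]\<close> has the runs
  \<open>[[3, 1], [2]]\<close>.\<close>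

definition epsilon :: "nat list \<Rightarrow> nat list" where
  "epsilon w = concat (rev (theta (desc_runs w)))"

subsection \<open>Dashed patterns\<close>

text \<open>A dashed pattern is the list of its dash-free blocks, so \<open>rev\<close> is the operation \<open>R\<close>: it reverses
  the order of the blocks and leaves each block unchanged.\<close>

definition dashed_pattern :: "nat list list \<Rightarrow> bool" where
  "dashed_pattern p \<longleftrightarrow> [] \<notin> set p \<and> (\<exists>r\<ge>1. set (concat p) = {1..r})"

definition piecewise_decreasing :: "nat list list \<Rightarrow> bool" where
  "piecewise_decreasing p \<longleftrightarrow> (\<forall>\<tau>\<in>set p. sorted_wrt (>) \<tau>)"

definition connected_pattern :: "nat list list \<Rightarrow> bool" where
  "connected_pattern p \<longleftrightarrow>
     (\<forall>i. Suc i < length p \<longrightarrow> \<not> comparable (p ! i) (p ! Suc i) \<or> p ! i = p ! Suc i)"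

text \<open>With letters indexed from 0: a dash separates the letters \<open>s\<close> and \<open>s + 1\<close>.\<close>

definition dash_after :: "nat list list \<Rightarrow> nat \<Rightarrow> bool" where
  "dash_after p s \<longleftrightarrow> (\<exists>j. 0 < j \<and> j < length p \<and> Suc s = length (concat (take j p)))"

definition occurrences :: "nat list list \<Rightarrow> nat list \<Rightarrow> nat list set" where
  "occurrences p w = {is. let a = concat p; q = length a in
     length is = q \<and> sorted_wrt (<) is \<and> set is \<subseteq> {..<length w} \<and>
     (\<forall>s<q. \<forall>t<q. w ! (is ! s) > w ! (is ! t) \<longleftrightarrow> a ! s > a ! t) \<and>
     (\<forall>s. Suc s < q \<and> \<not> dash_after p s \<longrightarrow> is ! Suc s = Suc (is ! s))}"

definition occ :: "nat list list \<Rightarrow> nat list \<Rightarrow> nat" where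
  "occ p w = card (occurrences p w)"

end

theory Submission
  imports Defs "HOL-Library.Sublist"
begin

text \<open>Exchanging two letters changes neither the relative order of equal letters nor that of
  incomparable ones, and these orders determine a maximal word of a class; reversal exchanges minimal
  and maximal words, which makes the map an involution. Consecutive blocks of a connected pattern
  cannot be placed inside one descending run, nor inside runs one of which is below the other. An
  occurrence of a connected pattern with prescribed values thus amounts to a subsequence of the runs
  whose members contain the successive blocks as factors, and the number of such subsequences is
  constant on each class and preserved when both the runs and the blocks are reversed.\<close>

section \<open>Minimal and maximal words\<close>

lemma below_trans: "below u v \<Longrightarrow> below v w \<Longrightarrow> v \<noteq> [] \<Longrightarrow> below u w"
  unfolding below_def by (metis last_in_set order.strict_trans)

lemma below_irrefl: "u \<noteq> [] \<Longrightarrow> \<not> below u u"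
  unfolding below_def by (metis last_in_set order.irrefl)

lemma below_asym: "below u v \<Longrightarrow> u \<noteq> [] \<Longrightarrow> v \<noteq> [] \<Longrightarrow> \<not> below v u"
  using below_trans below_irrefl by blast

lemma BB_nonempty: "D \<in> BB \<Longrightarrow> D \<noteq> []"
  by (simp add: BB_def)

lemma nonempty_if_lists_BB: "\<pi> \<in> lists BB \<Longrightarrow> [] \<notin> set \<pi>"
  using BB_nonempty by (auto simp: lists_eq_set)

lemma maximal_iff_successively: "maximal \<pi> \<longleftrightarrow> successively (\<lambda>D E. \<not> below D E) \<pi>"
  by (auto simp: maximal_def successively_conv_nth)

lemma minimal_iff_successively: "minimal \<pi> \<longleftrightarrow> successively (\<lambda>D E. \<not> below E D) \<pi>"
  by (auto simp: minimal_def successively_conv_nth)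

lemma maximal_rev: "maximal (rev \<pi>) \<longleftrightarrow> minimal \<pi>"
  by (simp add: maximal_iff_successively minimal_iff_successively)

lemma minimal_rev: "minimal (rev \<pi>) \<longleftrightarrow> maximal \<pi>"
  by (metis maximal_rev rev_rev_ident)

text \<open>The projection criterion for partially commutative monoids: a class is recorded by its
  restrictions to pairs of letters that may not be exchanged. The case \<open>A = B\<close> is
  included, so the multiplicity of every nonempty letter is recorded too.\<close>

definition same_projections :: "nat list list \<Rightarrow> nat list list \<Rightarrow> bool" where
  "same_projections \<pi> \<rho> \<longleftrightarrow> (\<forall>A B. \<not> below A B \<longrightarrow> \<not> below B A \<longrightarrow>
     filter (\<lambda>C. C = A \<or> C = B) \<pi> = filter (\<lambda>C. C = A \<or> C = B) \<rho>)"

lemma same_projections_sym: "same_projections \<pi> \<rho> \<Longrightarrow> same_projections \<rho> \<pi>"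
  by (simp add: same_projections_def)

lemma same_projections_set:
  assumes "same_projections \<pi> \<rho>" "[] \<notin> set \<pi>" "D \<in> set \<pi>"
  shows "D \<in> set \<rho>"
proof -
  have "\<not> below D D" using assms below_irrefl by metis
  then have "filter (\<lambda>C. C = D) \<pi> = filter (\<lambda>C. C = D) \<rho>"
    using assms(1) by (force simp: same_projections_def)
  then show ?thesis
    using assms(3) by (metis (mono_tags, lifting) filter_empty_conv)
qed

text \<open>All letters preceding the first occurrence of the head \<open>D\<close> of \<open>\<pi>\<close> in \<open>\<rho>\<close> are comparable to
  \<open>D\<close>; going from right to left, maximality and transitivity force \<open>D\<close> to be below each of them.\<close>

lemma same_projections_hd:
  assumes "same_projections (D # \<pi>) (E # \<rho>)" "maximal (E # \<rho>)" "[] \<notin> set (D # \<pi>)"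
    "[] \<notin> set (E # \<rho>)" "D \<noteq> E"
  shows "below D E"
proof -
  have "D \<in> set (E # \<rho>)" using same_projections_set assms(1,3) by (meson list.set_intros(1))
  then obtain \<alpha> \<beta> where split: "E # \<rho> = \<alpha> @ D # \<beta>" and D: "D \<notin> set \<alpha>"
    by (meson split_list_first)
  have comp: "below F D \<or> below D F" if "F \<in> set \<alpha>" for F
  proof (rule ccontr)
    assume "\<not> (below F D \<or> below D F)"
    \<comment> \<open>The left projection starts with \<open>D\<close>. The right one starts with a
      copy of \<open>F\<close>, because \<open>\<alpha>\<close> contains \<open>F\<close> but not
      \<open>D\<close>.\<close>
    then have "filter (\<lambda>C. C = D \<or> C = F) (D # \<pi>) = filter (\<lambda>C. C = D \<or> C = F) (\<alpha> @ D # \<beta>)"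
      using assms(1) split by (force simp: same_projections_def)
    moreover have "filter (\<lambda>C. C = D \<or> C = F) \<alpha> = filter (\<lambda>C. C = F) \<alpha>"
      using D by (intro filter_cong) auto
    moreover have "filter (\<lambda>C. C = F) \<alpha> \<noteq> []" using that by (auto simp: filter_empty_conv)
    moreover have "set (filter (\<lambda>C. C = F) \<alpha>) \<subseteq> {F}" by auto
    ultimately have "D = F"
      by (cases "filter (\<lambda>C. C = F) \<alpha>") auto
    then show False using that D by simp
  qed
  have "below D F" if "F \<in> set \<alpha>" "successively (\<lambda>D E. \<not> below D E) (\<alpha> @ [D])" for F
    using that comp assms(4)[unfolded split]
  proof (induction \<alpha> arbitrary: F)
    case (Cons G \<alpha>)
    have succ: "successively (\<lambda>D E. \<not> below D E) (\<alpha> @ [D])"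
      using Cons.prems(2) by (cases \<alpha>) auto
    have IH: "below D F" if "F \<in> set \<alpha>" for F
      using Cons.IH that succ Cons.prems by simp
    have "below D G"
    proof (cases \<alpha>)
      case Nil
      then show ?thesis using Cons.prems by auto
    next
      case (Cons H \<gamma>)
      then have "below D H" "\<not> below G H" using IH \<open>successively _ ((G # \<alpha>) @ [D])\<close> by auto
      moreover have "D \<noteq> []" using assms(3) by auto
      ultimately show ?thesis using Cons.prems(3)[of G] below_trans by fastforce
    qed
    then show ?case using IH Cons.prems(1) by auto
  qed simp
  moreover have "successively (\<lambda>D E. \<not> below D E) (\<alpha> @ [D])"
    using assms(2) unfolding split maximal_iff_successively
    by (metis append.assoc append_Cons append_Nil successively_append_iff)
  moreover have "E \<in> set \<alpha>" using split assms(5) by (cases \<alpha>) auto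
  ultimately show ?thesis by blast
qed

text \<open>If the heads differed, \<open>same_projections_hd\<close> used in both directions would
  put each below the other. A common head cancels from all projections, so induction applies to the
  tails.\<close>

lemma maximal_unique:
  assumes "same_projections \<pi> \<rho>" "maximal \<pi>" "maximal \<rho>" "[] \<notin> set \<pi>" "[] \<notin> set \<rho>"
  shows "\<pi> = \<rho>"
  using assms
proof (induction \<pi> arbitrary: \<rho>)
  case Nil
  then show ?case using same_projections_set[OF same_projections_sym] by (cases \<rho>) fastforce+
next
  case (Cons D \<pi>)
  have "D \<in> set \<rho>" using same_projections_set Cons.prems(1,4) by (meson list.set_intros(1))
  then obtain E \<rho>' where \<rho>: "\<rho> = E # \<rho>'" by (cases \<rho>) auto
  have DE: "E = D"
  proof (rule ccontr)
    assume "E \<noteq> D"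
    then have "below D E" "below E D"
      using same_projections_hd same_projections_sym Cons.prems \<rho> by metis+
    then show False using below_asym Cons.prems \<rho> by (metis list.set_intros(1))
  qed
  have "same_projections \<pi> \<rho>'"
    using Cons.prems(1) unfolding \<rho> DE same_projections_def by (auto split: if_splits)
  moreover have "maximal \<pi>" "maximal \<rho>'"
    using Cons.prems(2,3) \<rho> by (auto simp: maximal_iff_successively successively_Cons)
  ultimately have "\<pi> = \<rho>'" using Cons \<rho> by auto
  then show ?case using \<rho> DE by simp
qed

section \<open>The quotient monoid\<close>

lemma adjacentE:
  assumes "(\<pi>, \<rho>) \<in> adjacent"
  obtains \<alpha> \<beta> D E where "\<pi> = \<alpha> @ D # E # \<beta>" "\<rho> = \<alpha> @ E # D # \<beta>" "below D E \<or> below E D"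
    "\<pi> \<in> lists BB" "\<rho> \<in> lists BB"
proof -
  obtain \<alpha> \<beta> D E where "\<pi> = \<alpha> @ D # E # \<beta>" "\<rho> = \<alpha> @ E # D # \<beta>" "below D E \<or> below E D"
    using assms unfolding adjacent_def comparable_def ll_def by auto
  moreover have "\<pi> \<in> lists BB" "\<rho> \<in> lists BB"
    using assms unfolding adjacent_def by blast+
  ultimately show thesis using that by blast
qed

lemma adjacent_sym: "(\<pi>, \<rho>) \<in> adjacent \<Longrightarrow> (\<rho>, \<pi>) \<in> adjacent"
  unfolding adjacent_def comparable_def by blast

lemma adjacent_rev:
  assumes "(\<pi>, \<rho>) \<in> adjacent"
  shows "(rev \<pi>, rev \<rho>) \<in> adjacent"
proof -
  obtain \<alpha> \<beta> D E where *: "\<pi> = \<alpha> @ [D, E] @ \<beta>" "\<rho> = \<alpha> @ [E, D] @ \<beta>" "D \<noteq> E" "comparable D E"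
    "\<pi> \<in> lists BB" "\<rho> \<in> lists BB"
    using assms unfolding adjacent_def by blast
  have "rev \<pi> = rev \<beta> @ [E, D] @ rev \<alpha>" "rev \<rho> = rev \<beta> @ [D, E] @ rev \<alpha>"
    using * by auto
  moreover have "rev \<pi> \<in> lists BB" "rev \<rho> \<in> lists BB" "comparable E D"
    using * by (auto simp: lists_eq_set comparable_def)
  ultimately show ?thesis using *(3) unfolding adjacent_def by blast
qed

lemma adjacent_Cons: "(\<pi>, \<rho>) \<in> adjacent \<Longrightarrow> D \<in> BB \<Longrightarrow> (D # \<pi>, D # \<rho>) \<in> adjacent"
  unfolding adjacent_def by (auto) (metis append_Cons)

lemma rtrancl_adjacent_Cons:
  "(\<pi>, \<rho>) \<in> adjacent\<^sup>* \<Longrightarrow> D \<in> BB \<Longrightarrow> (D # \<pi>, D # \<rho>) \<in> adjacent\<^sup>*"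
  by (induction rule: rtrancl_induct) (auto intro: rtrancl_into_rtrancl adjacent_Cons)

lemma adjacent_swap:
  assumes "below D E" "D # E # \<beta> \<in> lists BB"
  shows "(D # E # \<beta>, E # D # \<beta>) \<in> adjacent"
proof -
  have "D \<noteq> E" using assms BB_nonempty below_irrefl by auto
  moreover have "E # D # \<beta> \<in> lists BB" using assms(2) by auto
  moreover have "D # E # \<beta> = [] @ [D, E] @ \<beta>" "E # D # \<beta> = [] @ [E, D] @ \<beta>" by auto
  moreover have "comparable D E" using assms(1) by (simp add: comparable_def ll_def)
  ultimately show ?thesis using assms(2) unfolding adjacent_def by blast
qed

lemma equivalent_rev: "(\<pi>, \<rho>) \<in> equivalent \<Longrightarrow> (rev \<pi>, rev \<rho>) \<in> equivalent"
proof -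
  assume *: "(\<pi>, \<rho>) \<in> equivalent"
  then have "(\<pi>, \<rho>) \<in> adjacent\<^sup>*" by (simp add: equivalent_def)
  then have "(rev \<pi>, rev \<rho>) \<in> adjacent\<^sup>*"
    by (induction rule: rtrancl_induct) (auto intro: rtrancl_into_rtrancl adjacent_rev)
  then show ?thesis using * by (auto simp: equivalent_def lists_eq_set)
qed

lemma equiv_equivalent: "equiv (lists BB) equivalent"
proof (rule equivI)
  have "sym adjacent" by (rule symI) (rule adjacent_sym)
  then have "sym (adjacent\<^sup>*)" by (rule sym_rtrancl)
  then show "sym equivalent" unfolding equivalent_def by (auto simp: sym_def)
  show "trans equivalent" unfolding equivalent_def by (auto simp: trans_def)
qed (auto simp: equivalent_def refl_on_def)

text \<open>Two exchanged letters are related by \<open>below\<close>, so they cannot both survive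
  in a projection onto letters that are not so related.\<close>

lemma equivalent_same_projections:
  assumes "(\<pi>, \<rho>) \<in> equivalent"
  shows "same_projections \<pi> \<rho>"
proof -
  have "(\<pi>, \<rho>) \<in> adjacent\<^sup>*" using assms by (simp add: equivalent_def)
  then show ?thesis
  proof (induction rule: rtrancl_induct)
    case base
    then show ?case by (simp add: same_projections_def)
  next
    case (step \<rho> \<sigma>)
    from step(2) have "same_projections \<rho> \<sigma>"
      by (rule adjacentE) (auto simp: same_projections_def)
    with step(3) show ?case by (simp add: same_projections_def)
  qed
qed

lemma equivalent_set: "(\<pi>, \<rho>) \<in> equivalent \<Longrightarrow> set \<pi> = set \<rho>"
proof -
  assume "(\<pi>, \<rho>) \<in> equivalent"
  then have "(\<pi>, \<rho>) \<in> adjacent\<^sup>*" by (simp add: equivalent_def)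
  then show ?thesis by (induction rule: rtrancl_induct) (auto elim!: adjacentE)
qed

section \<open>Existence and uniqueness of the maximal word of a class\<close>

text \<open>One step of an insertion sort: \<open>D\<close> travels to the right past the letters it
  is below. The clause on \<open>hd \<rho>\<close> is what allows the overtaken letter to be put
  back in front of \<open>\<rho>\<close>.\<close>

lemma maximal_insert:
  assumes "D # \<pi> \<in> lists BB" "maximal \<pi>"
  shows "\<exists>\<rho>\<in>lists BB. (D # \<pi>, \<rho>) \<in> adjacent\<^sup>* \<and> maximal \<rho> \<and> \<rho> \<noteq> [] \<and>
    (hd \<rho> = D \<or> \<pi> \<noteq> [] \<and> hd \<rho> = hd \<pi>)"
  using assms
proof (induction \<pi>)
  case Nil
  then show ?case by (intro bexI[of _ "[D]"]) (auto simp: maximal_iff_successively)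
next
  case (Cons E \<pi>)
  show ?case
  proof (cases "below D E")
    case False
    then show ?thesis using Cons.prems
      by (intro bexI[of _ "D # E # \<pi>"]) (auto simp: maximal_iff_successively)
  next
    case True
    have max: "maximal \<pi>" using Cons.prems(2) by (auto simp: maximal_iff_successively successively_Cons)
    then obtain \<rho> where \<rho>: "\<rho> \<in> lists BB" "(D # \<pi>, \<rho>) \<in> adjacent\<^sup>*" "maximal \<rho>" "\<rho> \<noteq> []"
      "hd \<rho> = D \<or> \<pi> \<noteq> [] \<and> hd \<rho> = hd \<pi>"
      using Cons.IH Cons.prems by auto
    have "(D # E # \<pi>, E # D # \<pi>) \<in> adjacent" using True Cons.prems(1) by (rule adjacent_swap)
    moreover have "(E # D # \<pi>, E # \<rho>) \<in> adjacent\<^sup>*"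
      using \<rho>(2) Cons.prems(1) by (intro rtrancl_adjacent_Cons) auto
    \<comment> \<open>If the head is \<open>D\<close>, asymmetry of \<open>below\<close> applies; if
      it is the head of \<open>\<pi>\<close>, maximality of \<open>E # \<pi>\<close> does.\<close>
    moreover have "\<not> below E (hd \<rho>)"
      using \<rho>(5) Cons.prems True below_asym[OF True] BB_nonempty
      by (auto simp: maximal_iff_successively successively_Cons)
    then have "maximal (E # \<rho>)"
      using \<rho> by (auto simp: maximal_iff_successively successively_Cons)
    ultimately show ?thesis using \<rho> Cons.prems
      by (intro bexI[of _ "E # \<rho>"]) auto
  qed
qed

lemma maximal_exists: "\<pi> \<in> lists BB \<Longrightarrow> \<exists>\<rho>. (\<pi>, \<rho>) \<in> equivalent \<and> maximal \<rho>"
proof (induction \<pi>)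
  case Nil
  have "([], []) \<in> equivalent" by (simp add: equivalent_def)
  moreover have "maximal []" by (simp add: maximal_def)
  ultimately show ?case by blast
next
  case (Cons D \<pi>)
  then obtain \<rho> where \<rho>: "(\<pi>, \<rho>) \<in> equivalent" "maximal \<rho>" by auto
  then obtain \<sigma> where \<sigma>: "\<sigma> \<in> lists BB" "(D # \<rho>, \<sigma>) \<in> adjacent\<^sup>*" "maximal \<sigma>"
    using maximal_insert[of D \<rho>] Cons.prems by (auto simp: equivalent_def)
  have "(D # \<pi>, D # \<rho>) \<in> adjacent\<^sup>*"
    using \<rho>(1) Cons.prems by (intro rtrancl_adjacent_Cons) (auto simp: equivalent_def)
  then show ?case using \<sigma> Cons.prems by (auto simp: equivalent_def)
qed

lemma maximal_equivalent_unique: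
  assumes "(\<pi>, \<rho>) \<in> equivalent" "maximal \<rho>" "(\<pi>, \<sigma>) \<in> equivalent" "maximal \<sigma>"
  shows "\<rho> = \<sigma>"
proof (rule maximal_unique)
  have "(\<rho>, \<sigma>) \<in> equivalent"
    using assms equiv_equivalent by (meson equivE symD transD)
  then show "same_projections \<rho> \<sigma>" by (rule equivalent_same_projections)
  show "[] \<notin> set \<rho>" "[] \<notin> set \<sigma>"
    using assms nonempty_if_lists_BB by (auto simp: equivalent_def)
qed (use assms in auto)

text \<open>Uniqueness turns the definite description into a computation rule: any maximal word
  exhibited in the class is the value.\<close>

lemma theta_eqI: "(\<pi>, \<rho>) \<in> equivalent \<Longrightarrow> maximal \<rho> \<Longrightarrow> theta \<pi> = \<rho>"
  unfolding theta_def L_class_def by (rule the_equality) (auto intro: maximal_equivalent_unique)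

lemma theta_equivalent: "\<pi> \<in> lists BB \<Longrightarrow> (\<pi>, theta \<pi>) \<in> equivalent"
  and maximal_theta: "\<pi> \<in> lists BB \<Longrightarrow> maximal (theta \<pi>)"
  using maximal_exists theta_eqI by metis+

section \<open>Descending runs\<close>

lemma desc_runs_eq_Nil_iff [simp]: "desc_runs w = [] \<longleftrightarrow> w = []"
  by (induction w rule: desc_runs.induct) (auto simp: Let_def)

lemma concat_desc_runs [simp]: "concat (desc_runs w) = w"
proof (induction w rule: desc_runs.induct)
  case (3 x y zs)
  then show ?case by (cases "desc_runs (y # zs)") (auto simp: Let_def)
qed auto

lemma hd_desc_runs: "w \<noteq> [] \<Longrightarrow> hd (desc_runs w) \<noteq> [] \<and> hd (hd (desc_runs w)) = hd w"
  by (induction w rule: desc_runs.induct) (auto simp: Let_def)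

lemma sorted_desc_runs: "D \<in> set (desc_runs w) \<Longrightarrow> D \<noteq> [] \<and> sorted_wrt (>) D"
proof (induction w arbitrary: D rule: desc_runs.induct)
  case (3 x y zs)
  obtain E \<pi> where E: "desc_runs (y # zs) = E # \<pi>" by (cases "desc_runs (y # zs)") auto
  have "E \<noteq> []" "hd E = y" using hd_desc_runs[of "y # zs"] E by auto
  moreover have "sorted_wrt (>) E" using 3 E by auto
  ultimately have "x > y \<Longrightarrow> sorted_wrt (>) (x # E)" by (cases E) auto
  then show ?case using 3 E by (auto simp: Let_def split: if_splits)
qed auto

lemma desc_runs_BB:
  assumes "w \<in> PP"
  shows "desc_runs w \<in> lists BB"
proof -
  have "set D \<subseteq> set w" if "D \<in> set (desc_runs w)" for D
    using that concat_desc_runs[of w] by (metis UN_upper set_concat)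
  then show ?thesis using assms sorted_desc_runs by (fastforce simp: BB_def PP_def lists_eq_set)
qed

text \<open>A decreasing word has its least letter at the end and its greatest at the front.
  Minimality of a word of runs therefore says that no descent occurs at the borders.\<close>

lemma not_below_iff_hd_last:
  assumes "D \<noteq> []" "sorted_wrt (>) D" "E \<noteq> []" "sorted_wrt (>) E"
  shows "\<not> below E D \<longleftrightarrow> last D \<le> hd E"
proof
  have D: "last D \<le> x" if "x \<in> set D" for x
    using that assms(2)
  proof (induction D)
    case (Cons y D)
    then show ?case using last_in_set[of D] by (cases "D = []") (auto intro: less_imp_le)
  qed simp
  have E: "x \<le> hd E" if "x \<in> set E" for x
    using that assms(3,4) by (cases E) auto
  show "last D \<le> hd E" if "\<not> below E D"
    using that D E by (auto simp: below_def not_less) (meson order_trans)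
  show "\<not> below E D" if "last D \<le> hd E"
    using that assms(1,3) hd_in_set last_in_set unfolding below_def by (meson leD)
qed

lemma minimal_desc_runs: "minimal (desc_runs w)"
proof (induction w rule: desc_runs.induct)
  case (3 x y zs)
  obtain E \<pi> where E: "desc_runs (y # zs) = E # \<pi>" by (cases "desc_runs (y # zs)") auto
  have y: "E \<noteq> []" "hd E = y" using hd_desc_runs[of "y # zs"] E by auto
  then have "y \<in> set E" by (metis hd_in_set)
  then show ?case using 3 E unfolding minimal_iff_successively
    by (cases \<pi>) (auto simp: Let_def below_def)
qed (auto simp: minimal_def)

lemma desc_runs_append:
  assumes "D \<noteq> []" "sorted_wrt (>) D" "w \<noteq> [] \<longrightarrow> last D \<le> hd w"
  shows "desc_runs (D @ w) = D # desc_runs w"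
  using assms
proof (induction D)
  case (Cons x D)
  show ?case
  proof (cases D)
    case Nil
    then show ?thesis using Cons.prems by (cases w) auto
  next
    case (Cons y D')
    then show ?thesis using Cons.IH Cons.prems by (simp add: Let_def)
  qed
qed simp

lemma minimal_hd_concat:
  assumes "minimal (D # \<pi>)" "\<forall>E\<in>set (D # \<pi>). E \<noteq> [] \<and> sorted_wrt (>) E" "\<pi> \<noteq> []"
  shows "last D \<le> hd (concat \<pi>)"
  using assms not_below_iff_hd_last[of D "hd \<pi>"]
  by (cases \<pi>) (auto simp: minimal_iff_successively)

text \<open>Minimality excludes descents between successive blocks, so cutting the concatenation at
  its non-descents restores them. With \<open>concat_desc_runs\<close> and
  \<open>minimal_desc_runs\<close>, words correspond bijectively to minimal words of nonempty
  decreasing blocks.\<close>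

lemma desc_runs_concat:
  assumes "minimal \<pi>" "\<forall>D\<in>set \<pi>. D \<noteq> [] \<and> sorted_wrt (>) D"
  shows "desc_runs (concat \<pi>) = \<pi>"
  using assms
proof (induction \<pi>)
  case (Cons D \<pi>)
  have "minimal \<pi>" using Cons.prems(1) by (auto simp: minimal_iff_successively successively_Cons)
  moreover have "concat \<pi> \<noteq> [] \<longrightarrow> last D \<le> hd (concat \<pi>)"
    using minimal_hd_concat[OF Cons.prems] by (cases "\<pi> = []") simp_all
  ultimately show ?case using Cons by (simp add: desc_runs_append)
qed simp

section \<open>The map epsilon\<close>

lemma desc_runs_epsilon:
  assumes "w \<in> PP"
  shows "desc_runs (epsilon w) = rev (theta (desc_runs w))"
  unfolding epsilon_def
proof (rule desc_runs_concat)
  have *: "desc_runs w \<in> lists BB" using assms by (rule desc_runs_BB)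
  then show "minimal (rev (theta (desc_runs w)))" using maximal_theta minimal_rev by blast
  have "theta (desc_runs w) \<in> lists BB" using theta_equivalent[OF *] by (simp add: equivalent_def)
  then show "\<forall>D\<in>set (rev (theta (desc_runs w))). D \<noteq> [] \<and> sorted_wrt (>) D"
    by (auto simp: BB_def lists_eq_set)
qed

lemma equivalent_epsilon: "w \<in> PP \<Longrightarrow> (desc_runs w, rev (desc_runs (epsilon w))) \<in> equivalent"
  using theta_equivalent desc_runs_BB desc_runs_epsilon by simp

lemma set_epsilon: "w \<in> PP \<Longrightarrow> set (epsilon w) = set w"
  using equivalent_set[OF equivalent_epsilon]
  by (metis concat_desc_runs set_concat set_rev)

lemma epsilon_PP: "w \<in> PP \<Longrightarrow> epsilon w \<in> PP"
  using set_epsilon by (auto simp: PP_def lists_eq_set)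

text \<open>Reversal turns \<open>equivalent_epsilon\<close> into an equivalence between
  \<open>desc_runs (epsilon w)\<close> and \<open>rev (desc_runs w)\<close>. The latter is maximal,
  hence equal to the value of \<open>theta\<close> needed for the second application.\<close>

lemma epsilon_epsilon:
  assumes "w \<in> PP"
  shows "epsilon (epsilon w) = w"
proof -
  have "(rev (desc_runs w), rev (rev (desc_runs (epsilon w)))) \<in> equivalent"
    using equivalent_epsilon[OF assms] by (rule equivalent_rev)
  then have "(desc_runs (epsilon w), rev (desc_runs w)) \<in> equivalent"
    using equiv_equivalent by (metis equivE rev_rev_ident symD)
  then have "theta (desc_runs (epsilon w)) = rev (desc_runs w)"
    using theta_eqI maximal_rev minimal_desc_runs by blast
  then show ?thesis unfolding epsilon_def[of "epsilon w"] by simp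
qed

section \<open>Counting occurrences with prescribed values\<close>

text \<open>The number of ways to locate the words of \<open>V\<close>, in this order, as
  non-overlapping factors of \<open>w\<close>; the recursion asks whether the first one starts at
  the first letter. The value 0 on an empty text is meant for nonempty \<open>v\<close>.\<close>

fun word_count :: "'a list list \<Rightarrow> 'a list \<Rightarrow> nat" where
  "word_count [] w = 1"
| "word_count (v # V) [] = 0"
| "word_count (v # V) (x # w) = word_count (v # V) w +
     (if prefix v (x # w) then word_count V (drop (length v) (x # w)) else 0)"

text \<open>The number of subsequences of \<open>\<pi>\<close> whose members contain the successive
  words of \<open>V\<close>. Only a run is chosen, not a position in it: a nonempty word occurs at
  most once as a factor of a strictly decreasing run.\<close>

fun run_count :: "'a list list \<Rightarrow> 'a list list \<Rightarrow> nat" where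
  "run_count [] \<pi> = 1"
| "run_count (v # V) [] = 0"
| "run_count (v # V) (D # \<pi>) = run_count (v # V) \<pi> + (if sublist v D then run_count V \<pi> else 0)"

text \<open>For nonempty words this means incomparable or equal, which is what connectedness demands
  of consecutive blocks.\<close>

definition linked :: "nat list \<Rightarrow> nat list \<Rightarrow> bool" where
  "linked u v \<longleftrightarrow> \<not> below u v \<and> \<not> below v u"

lemma linked_commute: "linked u v \<longleftrightarrow> linked v u"
  by (auto simp: linked_def)

section \<open>Invariance of the count over runs under reversal and exchange\<close>

lemma run_count_Nil_right: "V \<noteq> [] \<Longrightarrow> run_count V [] = 0"
  by (cases V) auto

text \<open>The mirror image of the defining recursion, deciding at the last run instead of the
  first; reversal invariance follows from it.\<close>

lemma run_count_snoc:
  "run_count (V @ [v]) (\<pi> @ [D]) =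
     run_count (V @ [v]) \<pi> + (if sublist v D then run_count V \<pi> else 0)"
proof (induction \<pi> arbitrary: V)
  case Nil
  then show ?case by (cases V) (auto simp: run_count_Nil_right)
next
  case (Cons E \<pi>)
  show ?case
  proof (cases V)
    case Nil
    then show ?thesis using Cons.IH[of "[]"] by simp
  next
    case (Cons u U)
    then show ?thesis using Cons.IH[of V] Cons.IH[of U] by simp
  qed
qed

lemma run_count_rev: "run_count (rev V) (rev \<pi>) = run_count V \<pi>"
proof (induction V \<pi> rule: run_count.induct)
  case (2 v V)
  then show ?case by (simp add: run_count_Nil_right)
qed (simp_all add: run_count_snoc)

lemma below_sublist: "below D E \<Longrightarrow> sublist u D \<Longrightarrow> sublist v E \<Longrightarrow> below u v"
  unfolding below_def by (meson set_mono_sublist subsetD)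

text \<open>A subsequence using both \<open>D\<close> and \<open>E\<close> would have consecutive
  words of \<open>V\<close> as factors of these two runs, and the words would inherit the relation
  \<open>below\<close>. Every counted subsequence thus uses at most one of the exchanged
  runs.\<close>

lemma run_count_swap:
  assumes "successively linked V" "below D E \<or> below E D"
  shows "run_count V (\<alpha> @ D # E # \<beta>) = run_count V (\<alpha> @ E # D # \<beta>)"
  using assms(1)
proof (induction \<alpha> arbitrary: V)
  case Nil
  show ?case
  proof (cases V)
    case (Cons u U)
    then show ?thesis using Nil assms(2) below_sublist
      by (cases U) (auto simp: linked_def)
  qed simp
next
  case (Cons F \<alpha>)
  then show ?case by (cases V) (auto simp: successively_Cons)
qed

lemma run_count_equivalent:
  assumes "(\<pi>, \<rho>) \<in> equivalent" "successively linked V"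
  shows "run_count V \<pi> = run_count V \<rho>"
proof -
  have "(\<pi>, \<rho>) \<in> adjacent\<^sup>*" using assms by (simp add: equivalent_def)
  then show ?thesis
  proof (induction rule: rtrancl_induct)
    case (step \<rho> \<sigma>)
    from step(2) have "run_count V \<rho> = run_count V \<sigma>"
      by (rule adjacentE) (use run_count_swap[OF assms(2)] in auto)
    with step(3) show ?case by simp
  qed simp
qed

section \<open>From factors of a word to subsequences of its runs\<close>

text \<open>A decreasing word that crossed the border of \<open>D\<close> would need a descent
  there.\<close>

lemma prefix_run:
  assumes "prefix v (D @ w)" "sorted_wrt (>) v" "D \<noteq> []" "w \<noteq> [] \<longrightarrow> last D \<le> hd (w :: nat list)"
  shows "prefix v D"
proof (rule ccontr)
  assume "\<not> prefix v D"
  then obtain z where z: "v = D @ z" "z \<noteq> []" "prefix z w"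
    using assms(1) unfolding prefix_append by auto
  then have "last D > hd z" using assms(2,3) by (auto simp: sorted_wrt_append)
  moreover have "hd z = hd w" "w \<noteq> []" using z by (auto simp: prefix_def)
  ultimately show False using assms(4) by simp
qed

text \<open>By \<open>prefix_run\<close> the first block lies inside \<open>D\<close> or starts in
  \<open>w\<close>. In the former case the next block does not fit into the rest of
  \<open>D\<close>, so \<open>V'\<close> is placed in \<open>w\<close> alone. The induction is on
  the length of \<open>D\<close> with \<open>V\<close> varying, as it is applied to the tail of
  \<open>D\<close> with \<open>V\<close> and to the rest behind the first block with
  \<open>V'\<close>.\<close>

lemma word_count_run:
  assumes "successively linked V" "\<forall>v\<in>set V. v \<noteq> [] \<and> sorted_wrt (>) v" "V = v # V'"
    "sorted_wrt (>) D" "D \<noteq> [] \<longrightarrow> w \<noteq> [] \<longrightarrow> last D \<le> hd w"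
  shows "word_count V (D @ w) = word_count V w + (if sublist v D then word_count V' w else 0)"
  using assms
proof (induction "length D" arbitrary: D V v V' rule: less_induct)
  case less
  have v: "v \<noteq> []" "sorted_wrt (>) v" using less.prems by auto
  show ?case
  proof (cases D)
    case Nil
    then show ?thesis using v by auto
  next
    case (Cons x D')
    have IH: "word_count V (D' @ w) = word_count V w + (if sublist v D' then word_count V' w else 0)"
      using less.hyps[of D' V v V'] less.prems Cons by (auto split: if_splits)
    have px: "prefix v (x # D' @ w) \<longleftrightarrow> prefix v (x # D')"
      using prefix_run[of v "x # D'" w] v less.prems Cons
      by (metis append_Cons list.discI prefix_prefix)
    \<comment> \<open>The letters of a run are distinct, so a block starting at \<open>x\<close>
      does not recur in \<open>D'\<close> and the two summands of the recursion never count the same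
      run twice.\<close>
    have disj: "\<not> sublist v D'" if "prefix v (x # D')"
    proof
      assume "sublist v D'"
      moreover have "x \<in> set v" using that v by (cases v) auto
      ultimately have "x \<in> set D'" by (meson set_mono_sublist subsetD)
      then show False using less.prems Cons by auto
    qed
    have drop: "word_count V' (drop (length v) (x # D' @ w)) = word_count V' w"
      if p: "prefix v (x # D')"
    proof (cases V')
      case Nil
      then show ?thesis by simp
    next
      case V': (Cons u U)
      obtain R where R: "x # D' = v @ R" using p by (auto simp: prefix_def)
      have srt: "sorted_wrt (>) (v @ R)" using less.prems Cons R by simp
      \<comment> \<open>What follows \<open>v\<close> in a decreasing run is below \<open>v\<close>.
        It cannot contain the next block \<open>u\<close>, which is linked to \<open>v\<close>, so
        the induction hypothesis for \<open>R\<close> leaves only the placements in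
        \<open>w\<close>.\<close>
      then have "below R v" by (auto simp: below_def sorted_wrt_append)
      have "\<not> sublist u R"
      proof
        assume "sublist u R"
        then have "below u v" using below_sublist[OF \<open>below R v\<close>] by blast
        then show False using less.prems V' by (auto simp: linked_def)
      qed
      moreover have "length R < length D"
        using arg_cong[OF R, of length] Cons v by simp
      moreover have "R \<noteq> [] \<longrightarrow> w \<noteq> [] \<longrightarrow> last R \<le> hd w"
        using less.prems(5) Cons R by (auto simp del: last.simps)
      ultimately have "word_count V' (R @ w) = word_count V' w"
        using less.hyps[of R V' u U] less.prems V' srt by (auto simp: sorted_wrt_append)
      moreover have "drop (length v) (x # D' @ w) = R @ w"
        using R by (metis append_Cons append_assoc append_eq_conv_conj)
      ultimately show ?thesis by simp
    qed
    show ?thesis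
      using less.prems(3) IH px disj drop Cons by (auto simp: sublist_Cons_right)
  qed
qed

text \<open>Runs are peeled off one at a time; minimality supplies the border condition of
  \<open>word_count_run\<close>.\<close>

lemma word_count_concat:
  assumes "minimal \<pi>" "\<forall>D\<in>set \<pi>. D \<noteq> [] \<and> sorted_wrt (>) D"
    "successively linked V" "\<forall>v\<in>set V. v \<noteq> [] \<and> sorted_wrt (>) v"
  shows "word_count V (concat \<pi>) = run_count V \<pi>"
  using assms
proof (induction V \<pi> rule: run_count.induct)
  case (3 v V D \<pi>)
  have "minimal \<pi>" "successively linked V"
    using "3.prems" by (auto simp: minimal_iff_successively successively_Cons)
  moreover have "D \<noteq> [] \<longrightarrow> concat \<pi> \<noteq> [] \<longrightarrow> last D \<le> hd (concat \<pi>)"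
    using minimal_hd_concat[of D \<pi>] "3.prems" by auto
  ultimately show ?case
    using 3 word_count_run[of "v # V" v V D "concat \<pi>"] by auto
qed auto

section \<open>Occurrences\<close>

text \<open>The position lists behind \<open>word_count V (drop k w)\<close>: each block occupies an
  interval, and \<open>k\<close> bounds the first start from below.\<close>

fun placed :: "'a list list \<Rightarrow> 'a list \<Rightarrow> nat \<Rightarrow> nat list \<Rightarrow> bool" where
  "placed [] w k is \<longleftrightarrow> is = []"
| "placed (v # V) w k is \<longleftrightarrow> (\<exists>i js. k \<le> i \<and> is = [i..<i + length v] @ js \<and> prefix v (drop i w) \<and>
     placed V w (i + length v) js)"

text \<open>The placements split as in the recursion of \<open>word_count\<close>: the first block
  starts at \<open>k\<close> or later. Either \<open>V\<close> becomes shorter or \<open>k\<close>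
  grows, which explains the induction measure.\<close>

lemma finite_placed_card:
  assumes "[] \<notin> set V"
  shows "finite {is. placed V w k is} \<and> card {is. placed V w k is} = word_count V (drop k w)"
  using assms
proof (induction "length V + (length w - k)" arbitrary: V k rule: less_induct)
  case less
  show ?case
  proof (cases V)
    case Nil
    have "Collect (placed [] w k) = {[]}" by auto
    then show ?thesis by (simp add: Nil)
  next
    case V: (Cons v V')
    have v: "v \<noteq> []" using less.prems V by auto
    show ?thesis
    proof (cases "k < length w")
      case False
      have "\<not> placed V w k is" for "is"
        using False V v by (auto simp: drop_all)
      then have empty: "Collect (placed V w k) = {}" by blast
      show ?thesis unfolding empty using V False by simp
    next
      case True
      let ?A = "{is. placed V w (Suc k) is}"
      let ?B = "if prefix v (drop k w)
        then (\<lambda>js. [k..<k + length v] @ js) ` {js. placed V' w (k + length v) js} else {}"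
      have eq: "{is. placed V w k is} = ?A \<union> ?B"
      proof (intro set_eqI iffI)
        fix "is" assume "is \<in> {is. placed V w k is}"
        then obtain i js where *: "k \<le> i" "is = [i..<i + length v] @ js" "prefix v (drop i w)"
          "placed V' w (i + length v) js"
          unfolding V by auto
        show "is \<in> ?A \<union> ?B"
        proof (cases "i = k")
          case True
          then show ?thesis using * by simp
        next
          case False
          then have "Suc k \<le> i" using *(1) by simp
          then have "placed V w (Suc k) is" unfolding V placed.simps using * by blast
          then show ?thesis by simp
        qed
      next
        fix "is" assume "is \<in> ?A \<union> ?B"
        then consider "placed V w (Suc k) is" | "is \<in> ?B" by blast
        then show "is \<in> {is. placed V w k is}"
        proof cases
          case 1
          then show ?thesis unfolding V placed.simps using Suc_leD by blast
        next
          case 2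
          then show ?thesis unfolding V placed.simps by (auto split: if_splits)
        qed
      qed
      \<comment> \<open>Since \<open>v\<close> is nonempty, the head of a position list is the start
        of the first block; it tells the two cases apart.\<close>
      have hd: "hd is > k" if "is \<in> ?A" for "is"
        using that v V by (auto simp: hd_append)
      have hd': "hd is = k" if "is \<in> ?B" for "is"
        using that v by (auto simp: hd_append split: if_splits)
      have disj: "?A \<inter> ?B = {}"
      proof (intro equals0I)
        fix "is" assume "is \<in> ?A \<inter> ?B"
        then have "is \<in> ?A" "is \<in> ?B" by (rule IntD1, rule IntD2)
        then show False using hd[of "is"] hd'[of "is"] by linarith
      qed
      have IHA: "finite ?A" "card ?A = word_count V (drop (Suc k) w)"
        using less.hyps[of V "Suc k"] less.prems True by auto
      have IHB: "finite {js. placed V' w (k + length v) js}"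
        "card {js. placed V' w (k + length v) js} = word_count V' (drop (k + length v) w)"
        using less.hyps[of V' "k + length v"] less.prems V by auto
      have "finite ?B" using IHB by auto
      moreover have "card ?B =
          (if prefix v (drop k w) then word_count V' (drop (k + length v) w) else 0)"
        using IHB by (auto simp: card_image inj_on_def)
      moreover have "word_count V (drop k w) = word_count V (drop (Suc k) w) +
          (if prefix v (drop k w) then word_count V' (drop (k + length v) w) else 0)"
      proof -
        have "drop k w = w ! k # drop (Suc k) w" using True by (rule Cons_nth_drop_Suc[symmetric])
        then show ?thesis
          unfolding V by (metis add.commute drop_drop word_count.simps(3))
      qed
      ultimately show ?thesis
        unfolding eq using IHA disj by (simp add: card_Un_disjoint)
    qed
  qed
qed

section \<open>Placements of blocks and the positionwise description of occurrences\<close>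

text \<open>The adjacency condition of \<open>occurrences\<close> in isolation. It depends on
  \<open>V\<close> only through the block lengths, so a pattern shares it with its
  relabellings.\<close>

definition contiguous :: "nat list list \<Rightarrow> nat list \<Rightarrow> bool" where
  "contiguous V is \<longleftrightarrow> (\<forall>s. Suc s < length (concat V) \<and> \<not> dash_after V s \<longrightarrow>
     is ! Suc s = Suc (is ! s))"

lemma dash_after_Cons:
  "dash_after (v # V) s \<longleftrightarrow>
     V \<noteq> [] \<and> Suc s = length v \<or> length v \<le> s \<and> dash_after V (s - length v)"
proof
  assume "dash_after (v # V) s"
  then obtain j where "0 < j" "j < Suc (length V)" "Suc s = length (concat (take j (v # V)))"
    by (auto simp: dash_after_def)
  then obtain i where i: "i < length V" "Suc s = length v + length (concat (take i V))"
    by (cases j) auto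
  show "V \<noteq> [] \<and> Suc s = length v \<or> length v \<le> s \<and> dash_after V (s - length v)"
  \<comment> \<open>If no letter of \<open>V\<close> precedes the dash, it stands right after
    \<open>v\<close>; otherwise it is a dash of \<open>V\<close>, shifted by
    \<open>length v\<close>.\<close>
  proof (cases "length (concat (take i V)) = 0")
    case True
    then show ?thesis using i by auto
  next
    case False
    then have "0 < i" by (cases i) simp_all
    moreover have "length v \<le> s" "Suc (s - length v) = length (concat (take i V))"
      using False i(2) by linarith+
    ultimately
    show ?thesis using i(1) by (auto simp: dash_after_def)
  qed
next
  assume "V \<noteq> [] \<and> Suc s = length v \<or> length v \<le> s \<and> dash_after V (s - length v)"
  then show "dash_after (v # V) s"
  proof
    assume "V \<noteq> [] \<and> Suc s = length v"
    then show ?thesis by (auto simp: dash_after_def intro!: exI[of _ 1])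
  next
    assume *: "length v \<le> s \<and> dash_after V (s - length v)"
    then obtain j where "0 < j" "j < length V" "Suc (s - length v) = length (concat (take j V))"
      by (auto simp: dash_after_def)
    then show ?thesis using * by (auto simp: dash_after_def intro!: exI[of _ "Suc j"])
  qed
qed

lemma contiguous_Cons:
  assumes "length is = length v"
  shows "contiguous (v # V) (is @ js) \<longleftrightarrow>
    (\<forall>s. Suc s < length v \<longrightarrow> is ! Suc s = Suc (is ! s)) \<and> contiguous V js"
proof (intro iffI conjI allI impI)
  fix s assume "contiguous (v # V) (is @ js)" "Suc s < length v"
  then show "is ! Suc s = Suc (is ! s)"
    using assms unfolding contiguous_def by (auto simp: dash_after_Cons nth_append dest!: spec[of _ s])
next
  assume *: "contiguous (v # V) (is @ js)"
  show "contiguous V js" unfolding contiguous_def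
  proof (intro allI impI)
    fix s assume "Suc s < length (concat V) \<and> \<not> dash_after V s"
    then show "js ! Suc s = Suc (js ! s)"
      using *[unfolded contiguous_def, rule_format, of "length v + s"] assms
      by (auto simp: dash_after_Cons nth_append)
  qed
next
  assume *: "(\<forall>s. Suc s < length v \<longrightarrow> is ! Suc s = Suc (is ! s)) \<and> contiguous V js"
  show "contiguous (v # V) (is @ js)" unfolding contiguous_def
  proof (intro allI impI)
    fix s assume s: "Suc s < length (concat (v # V)) \<and> \<not> dash_after (v # V) s"
    consider "Suc s < length v" | "Suc s = length v" | "length v \<le> s" by linarith
    then show "(is @ js) ! Suc s = Suc ((is @ js) ! s)"
    proof cases
      case 1
      then show ?thesis using * assms by (simp add: nth_append)
    next
      case 2
      \<comment> \<open>Nothing is required at the end of \<open>v\<close>: either a dash stands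
        there, or \<open>V\<close> is empty and the index is out of range.\<close>
      then show ?thesis using s by (cases V) (auto simp: dash_after_Cons)
    next
      case 3
      then have "Suc (s - length v) < length (concat V) \<and> \<not> dash_after V (s - length v)"
        using s by (auto simp: dash_after_Cons)
      then have "js ! Suc (s - length v) = Suc (js ! (s - length v))"
        using * by (auto simp: contiguous_def)
      then show ?thesis using 3 assms by (simp add: nth_append Suc_diff_le)
    qed
  qed
qed

lemma successor_list_eq_upt:
  assumes "\<forall>s. Suc s < length is \<longrightarrow> is ! Suc s = Suc (is ! s)"
  shows "is = [hd is..<hd is + length is]"
proof (cases "is")
  case (Cons i js)
  have "is ! s = i + s" if "s < length is" for s
    using that by (induction s) (use assms Cons in auto)
  then have "is ! s = [hd is..<hd is + length is] ! s" if "s < length is" for s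
    using that Cons by (simp del: upt_Suc)
  then show ?thesis by (intro nth_equalityI) simp_all
qed simp

text \<open>The bound on \<open>i\<close> matters for \<open>v = []\<close>, which is a prefix of
  \<open>drop i w\<close> even when \<open>i\<close> lies beyond the end of
  \<open>w\<close>.\<close>

lemma prefix_drop_iff:
  "i \<le> length w \<Longrightarrow> prefix v (drop i w) \<longleftrightarrow>
     i + length v \<le> length w \<and> map ((!) w) [i..<i + length v] = v"
proof
  assume "i \<le> length w" "prefix v (drop i w)"
  then obtain z where "drop i w = v @ z" "i \<le> length w" by (auto simp: prefix_def)
  moreover from this have "length w = i + length v + length z"
    by (metis add.assoc append_take_drop_id length_append length_take min.absorb2)
  moreover have "w ! (i + s) = v ! s" if "s < length v" for s
    using calculation that by (metis nth_append nth_drop)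
  ultimately show "i + length v \<le> length w \<and> map ((!) w) [i..<i + length v] = v"
    by (intro conjI nth_equalityI) auto
next
  assume *: "i + length v \<le> length w \<and> map ((!) w) [i..<i + length v] = v"
  have "take (length v) (drop i w) = map ((!) w) [i..<i + length v]"
    by (intro nth_equalityI) (use conjunct1[OF *] in simp_all)
  then show "prefix v (drop i w)" using * by (metis take_is_prefix)
qed

lemma placed_iff:
  assumes "[] \<notin> set V"
  shows "placed V w k is \<longleftrightarrow> length is = length (concat V) \<and> sorted_wrt (<) is \<and>
    set is \<subseteq> {k..<length w} \<and> map ((!) w) is = concat V \<and> contiguous V is"
  using assms
proof (induction V arbitrary: k "is")
  case Nil
  then show ?case by (auto simp: contiguous_def)
next
  case (Cons v V)
  have v: "v \<noteq> []" using Cons.prems by auto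
  show ?case
  proof
    assume "placed (v # V) w k is"
    then obtain i js where *: "k \<le> i" "is = [i..<i + length v] @ js" "prefix v (drop i w)"
      "placed V w (i + length v) js" by auto
    have "i \<le> length w" using *(3) v by (metis drop_all nat_le_linear prefix_Nil)
    then have "i + length v \<le> length w" "map ((!) w) [i..<i + length v] = v"
      using *(3) prefix_drop_iff by blast+
    then show "length is = length (concat (v # V)) \<and> sorted_wrt (<) is \<and>
      set is \<subseteq> {k..<length w} \<and> map ((!) w) is = concat (v # V) \<and> contiguous (v # V) is"
      using * Cons by (auto simp: sorted_wrt_append contiguous_Cons subset_iff)
  next
    assume *: "length is = length (concat (v # V)) \<and> sorted_wrt (<) is \<and>
      set is \<subseteq> {k..<length w} \<and> map ((!) w) is = concat (v # V) \<and> contiguous (v # V) is"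
    define hs js where "hs = take (length v) is" and "js = drop (length v) is"
    have len: "length hs = length v" and "is": "is = hs @ js"
      using * by (auto simp: hs_def js_def)
    have cont: "\<forall>s. Suc s < length v \<longrightarrow> hs ! Suc s = Suc (hs ! s)" "contiguous V js"
      using * unfolding "is" contiguous_Cons[OF len] by auto
    define i where "i = hd hs"
    have hs: "hs = [i..<i + length v]"
      using successor_list_eq_upt[of hs] cont(1) len unfolding i_def by simp
    have mp: "map ((!) w) hs = v" "map ((!) w) js = concat V"
      using * len unfolding "is" by auto
    \<comment> \<open>As \<open>v\<close> is nonempty, \<open>i + length v - 1\<close> is the last
      position of its block; it must lie in \<open>w\<close> and precede all positions in
      \<open>js\<close>.\<close>
    have lst: "i + length v - 1 \<in> set hs" "i \<in> set hs" using hs v by (cases v; simp)+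
    then have "i + length v - 1 < length w" "k \<le> i" using * unfolding "is" by auto
    then have il: "i + length v \<le> length w" by linarith
    then have "prefix v (drop i w)" using mp(1) hs prefix_drop_iff[of i w v] by simp
    moreover have "placed V w (i + length v) js"
    proof -
      have srt: "sorted_wrt (<) (hs @ js)" and sub: "set (hs @ js) \<subseteq> {k..<length w}"
        using * unfolding "is" by blast+
      have "set js \<subseteq> {i + length v..<length w}"
      proof
        fix j assume j: "j \<in> set js"
        then have "i + length v - 1 < j" using srt lst(1) unfolding sorted_wrt_append by blast
        moreover have "j < length w" using j sub by auto
        ultimately show "j \<in> {i + length v..<length w}" by simp
      qed
      moreover have "sorted_wrt (<) js" using srt unfolding sorted_wrt_append by blast
      moreover have "length js = length (concat V)" using mp(2) by (metis length_map)
      moreover have "[] \<notin> set V" using Cons.prems by simp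
      ultimately show ?thesis using Cons.IH mp(2) cont(2) by blast
    qed
    ultimately show "placed (v # V) w k is" using \<open>k \<le> i\<close> "is" hs by auto
  qed
qed

section \<open>Splitting the occurrences of a pattern by their values\<close>

text \<open>The patterns with letters replaced, in an order-preserving way, by values from
  \<open>S\<close>. The set collects the relabelled patterns and not the maps \<open>f\<close>,
  since many maps agree on the letters of \<open>p\<close>.\<close>

definition instances :: "nat list list \<Rightarrow> nat set \<Rightarrow> nat list list set" where
  "instances p S =
     {map (map f) p |f. strict_mono_on (set (concat p)) f \<and> f ` set (concat p) \<subseteq> S}"

lemma finite_instances:
  assumes "finite S"
  shows "finite (instances p S)"
proof (rule finite_subset)
  let ?B = "{v. set v \<subseteq> S \<and> length v \<le> length (concat p)}"
  have "length v \<le> length (concat p)" if "v \<in> set p" for v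
    using that by (auto simp: length_concat member_le_sum_list)
  then show "instances p S \<subseteq> {V. set V \<subseteq> ?B \<and> length V = length p}"
    by (fastforce simp: instances_def)
  show "finite {V. set V \<subseteq> ?B \<and> length V = length p}"
    using assms by (intro finite_lists_length_eq finite_lists_length_le)
qed

lemma instances_rev: "instances (rev p) S = rev ` instances p S"
  unfolding instances_def by (force simp: rev_map)

lemma contiguous_map: "contiguous (map (map f) p) is \<longleftrightarrow> contiguous p is"
  by (simp add: contiguous_def dash_after_def take_map flip: map_concat)

lemma strict_mono_on_less_iff:
  fixes f :: "nat \<Rightarrow> nat"
  assumes "strict_mono_on A f" "x \<in> A" "y \<in> A"
  shows "f x < f y \<longleftrightarrow> x < y"
  using assms strict_mono_on_less by blast

lemma order_isomorphic_map:
  fixes a b :: "nat list"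
  assumes "length a = length b"
    "\<forall>s<length a. \<forall>t<length a. b ! s > b ! t \<longleftrightarrow> a ! s > a ! t"
  obtains f where "b = map f a" "strict_mono_on (set a) f"
proof
  define f where "f c = b ! (SOME s. s < length a \<and> a ! s = c)" for c
  have f: "f (a ! s) = b ! s" if "s < length a" for s
  proof -
    define t where "t = (SOME t. t < length a \<and> a ! t = a ! s)"
    have "t < length a \<and> a ! t = a ! s"
      unfolding t_def by (rule someI) (use that in auto)
    \<comment> \<open>Positions with equal letters in \<open>a\<close> carry equal entries in
      \<open>b\<close>, as neither strict inequality can hold; hence \<open>f\<close> does not
      depend on the chosen position.\<close>
    then have "\<not> b ! s < b ! t" "\<not> b ! t < b ! s" using assms(2) that by auto
    then show ?thesis unfolding f_def t_def[symmetric] by simp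
  qed
  show "b = map f a" using assms(1) f by (intro nth_equalityI) auto
  show "strict_mono_on (set a) f"
    using assms(2) f by (auto simp: strict_mono_on_def in_set_conv_nth)
qed

text \<open>The values found at the positions of an occurrence form an order-preserving relabelling
  of \<open>p\<close>, and \<open>placed_iff\<close> translates the remaining conditions.\<close>

lemma occurrences_eq_Union:
  assumes "[] \<notin> set p"
  shows "occurrences p w = (\<Union>V\<in>instances p (set w). {is. placed V w 0 is})"
proof (intro set_eqI iffI)
  fix "is" assume *: "is \<in> occurrences p w"
  then have len: "length (concat p) = length (map ((!) w) is)"
    by (simp add: occurrences_def Let_def)
  moreover have "\<forall>s<length (concat p). \<forall>t<length (concat p).
      map ((!) w) is ! s > map ((!) w) is ! t \<longleftrightarrow> concat p ! s > concat p ! t"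
    using * len by (auto simp: occurrences_def Let_def)
  ultimately obtain f where f: "map ((!) w) is = map f (concat p)" "strict_mono_on (set (concat p)) f"
    using order_isomorphic_map by metis
  let ?V = "map (map f) p"
  have "set is \<subseteq> {..<length w}" using * by (auto simp: occurrences_def Let_def)
  then have "f ` set (concat p) \<subseteq> set w"
    using arg_cong[OF f(1), of set]
    by (metis image_mono image_set lessThan_atLeast0 list.set_map map_nth set_upt)
  then have "?V \<in> instances p (set w)" using f(2) by (auto simp: instances_def simp del: set_concat)
  moreover have "[] \<notin> set ?V" using assms by auto
  then have "placed ?V w 0 is"
    using * f(1) by (simp add: placed_iff contiguous_map map_concat[symmetric] del: map_map)
      (simp add: occurrences_def Let_def contiguous_def atLeast0LessThan)
  ultimately show "is \<in> (\<Union>V\<in>instances p (set w). {is. placed V w 0 is})" by blast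
next
  fix "is" assume "is \<in> (\<Union>V\<in>instances p (set w). {is. placed V w 0 is})"
  then obtain f where f: "strict_mono_on (set (concat p)) f" "placed (map (map f) p) w 0 is"
    by (auto simp: instances_def)
  have "[] \<notin> set (map (map f) p)" using assms by auto
  then have *: "length is = length (concat p)" "sorted_wrt (<) is" "set is \<subseteq> {..<length w}"
    "map ((!) w) is = map f (concat p)" "contiguous p is"
    using f(2) by (auto simp: placed_iff contiguous_map map_concat[symmetric])
  have "w ! (is ! s) = f (concat p ! s)" if "s < length (concat p)" for s
    using that *(1,4) by (metis nth_map)
  then have "\<forall>s<length (concat p). \<forall>t<length (concat p).
      w ! (is ! s) > w ! (is ! t) \<longleftrightarrow> concat p ! s > concat p ! t"
    using strict_mono_on_less_iff[OF f(1)] nth_mem by metis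
  then show "is \<in> occurrences p w"
    using * by (auto simp: occurrences_def Let_def contiguous_def)
qed

lemma map_length_concat_inject:
  "map length U = map length V \<Longrightarrow> concat U = concat V \<Longrightarrow> U = V"
proof (induction U arbitrary: V)
  case (Cons u U)
  then show ?case by (cases V) auto
qed simp

text \<open>The union is disjoint: positions determine the concatenated values, and all instances
  are cut into blocks of the same lengths as \<open>p\<close>.\<close>

lemma occ_eq_sum:
  assumes "[] \<notin> set p"
  shows "occ p w = (\<Sum>V\<in>instances p (set w). word_count V w)"
proof -
  have ne: "[] \<notin> set V" if "V \<in> instances p (set w)" for V
    using that assms by (auto simp: instances_def)
  have "U = V" if "U \<in> instances p (set w)" "V \<in> instances p (set w)" "placed U w 0 is" "placed V w 0 is"
    for U V "is"
  proof (rule map_length_concat_inject)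
    show "map length U = map length V" using that by (auto simp: instances_def)
    show "concat U = concat V" using that ne placed_iff by metis
  qed
  then have "occ p w = (\<Sum>V\<in>instances p (set w). card {is. placed V w 0 is})"
    unfolding occ_def occurrences_eq_Union[OF assms]
    using finite_placed_card ne finite_instances by (intro card_UN_disjoint) blast+
  also have "\<dots> = (\<Sum>V\<in>instances p (set w). word_count V w)"
  proof (rule sum.cong)
    fix V assume "V \<in> instances p (set w)"
    then show "card {is. placed V w 0 is} = word_count V w"
      using finite_placed_card[of V w 0] ne by simp
  qed simp
  finally show ?thesis .
qed

section \<open>Transfer of pattern counts along \<open>epsilon\<close>\<close>

lemma occ_rev_epsilon:
  assumes "dashed_pattern p" "piecewise_decreasing p" "connected_pattern p" "w \<in> PP"
  shows "occ p w = occ (rev p) (epsilon w)"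
proof -
  have ne: "[] \<notin> set p" using assms(1) by (simp add: dashed_pattern_def)
  \<comment> \<open>Incomparable blocks are linked by definition; equal ones are because a nonempty
    word is not below itself.\<close>
  have linked: "successively linked p"
    unfolding successively_conv_nth
  proof (intro allI impI)
    fix i assume i: "Suc i < length p"
    then have "p ! i \<noteq> []" using ne by (metis Suc_lessD nth_mem)
    then show "linked (p ! i) (p ! Suc i)"
      using i assms(3) below_irrefl
      by (fastforce simp: connected_pattern_def linked_def comparable_def ll_def)
  qed
  have inst: "successively linked V \<and> (\<forall>v\<in>set V. v \<noteq> [] \<and> sorted_wrt (>) v)"
    if V_inst: "V \<in> instances p S" for V S
  proof -
    obtain f where V: "V = map (map f) p" and f: "strict_mono_on (set (concat p)) f"
      using V_inst unfolding instances_def by blast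
    \<comment> \<open>An increasing relabelling preserves and reflects \<open>below\<close>, so
      links pass from the pattern to its instances.\<close>
    have below: "below (map f u) (map f v) \<longleftrightarrow> below u v" if "u \<in> set p" "v \<in> set p" for u v
      using strict_mono_on_less_iff[OF f] that by (auto simp: below_def)
    have "successively linked V"
      using linked unfolding V successively_map
      by (rule successively_mono) (simp add: linked_def below)
    moreover have "sorted_wrt (>) (map f v)" if "v \<in> set p" for v
    proof -
      have "sorted_wrt (>) v" using assms(2) that by (simp add: piecewise_decreasing_def)
      then show ?thesis unfolding sorted_wrt_map
        by (rule sorted_wrt_mono_rel[rotated]) (use strict_mono_on_less_iff[OF f] that in auto)
    qed
    ultimately show ?thesis using ne V by auto
  qed
  have count: "word_count V u = run_count V (desc_runs u)"
    if "successively linked V" "\<forall>v\<in>set V. v \<noteq> [] \<and> sorted_wrt (>) v" for V u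
    using word_count_concat[of "desc_runs u" V] that minimal_desc_runs sorted_desc_runs by auto
  have "word_count V w = word_count (rev V) (epsilon w)" if "V \<in> instances p (set w)" for V
  proof -
    have V: "successively linked V" "\<forall>v\<in>set V. v \<noteq> [] \<and> sorted_wrt (>) v"
      using inst that by blast+
    have "word_count V w = run_count V (desc_runs w)" using V count by blast
    also have "\<dots> = run_count V (rev (desc_runs (epsilon w)))"
      using equivalent_epsilon[OF assms(4)] V(1) by (rule run_count_equivalent)
    also have "\<dots> = run_count (rev V) (desc_runs (epsilon w))"
      by (metis run_count_rev rev_rev_ident)
    also have "\<dots> = word_count (rev V) (epsilon w)"
    proof -
      have "successively linked (rev V)"
        unfolding successively_rev
        using V(1) by (rule successively_mono) (simp add: linked_commute)
      then show ?thesis using V(2) count[of "rev V"] by simp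
    qed
    finally show ?thesis .
  qed
  then have "occ p w = (\<Sum>V\<in>instances p (set w). word_count (rev V) (epsilon w))"
    by (simp add: occ_eq_sum ne)
  \<comment> \<open>Reindexing along list reversal, which is injective.\<close>
  also have "\<dots> = (\<Sum>V\<in>instances (rev p) (set w). word_count V (epsilon w))"
    unfolding instances_rev by (simp add: sum.reindex)
  \<comment> \<open>Both sums use the same set of values, because \<open>epsilon\<close> preserves
    the set of letters.\<close>
  also have "\<dots> = occ (rev p) (epsilon w)"
    using ne set_epsilon[OF assms(4)] by (simp add: occ_eq_sum)
  finally show ?thesis .
qed

theorem theorem3p4:
  shows "bij_betw epsilon PP PP \<and>
    (\<forall>ps. (\<forall>p\<in>set ps. dashed_pattern p \<and> piecewise_decreasing p \<and> connected_pattern p) \<longrightarrow>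
      (\<forall>w\<in>PP. map (\<lambda>p. occ p w) ps = map (\<lambda>p. occ (rev p) (epsilon w)) ps)) \<and>
    (\<forall>w\<in>PP. L_class (desc_runs w) = L_class (rev (desc_runs (epsilon w))))"
proof (intro conjI)
  show "bij_betw epsilon PP PP"
    by (rule bij_betw_byWitness[where f' = epsilon]) (auto simp: epsilon_epsilon epsilon_PP)
  show "\<forall>ps. (\<forall>p\<in>set ps. dashed_pattern p \<and> piecewise_decreasing p \<and> connected_pattern p) \<longrightarrow>
      (\<forall>w\<in>PP. map (\<lambda>p. occ p w) ps = map (\<lambda>p. occ (rev p) (epsilon w)) ps)"
    using occ_rev_epsilon by auto
  show "\<forall>w\<in>PP. L_class (desc_runs w) = L_class (rev (desc_runs (epsilon w)))"
    unfolding L_class_def using equivalent_epsilon equiv_equivalent equiv_class_eq by metis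
qed

end
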